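(* Let $n\ge 1$ and let $B\in\mathbb{R}^{2n\times 2n}$ be a symmetric matrix. Let $J=\begin{bmatrix}0&-I_n\\ I_n&0\end{bmatrix}\in\mathbb{R}^{2n\times 2n}$. If the nullity of $B$ is odd or the Morse index of $B$ is odd, then the matrix $JB$ is linearly unstable.
   Context: For a real symmetric matrix $B$, the nullity is $\dim\ker B$ and the Morse index is the number of negative eigenvalues of $B$ counted with multiplicity. The matrix $JB\in\mathbb{R}^{2n\times 2n}$ is called spectrally stable if all of its (complex) eigenvalues lie on the imaginary axis; it is called linearly stable if it is spectrally stable and semi-simple (i.e. diagonalizable over $\mathbb{C}$); it is called linearly unstable if it is not linearly stable. *)

theory Defs
  imports
    Complex_Main
    "Jordan_Normal_Form.Char_Poly"
    "Jordan_Normal_Form.Matrix_Kernel"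
begin

text \<open>
  \<^const>\<open>Polynomial.order\<close> is the algebraic multiplicity; the index set is finite for every
  square matrix.
\<close>

definition morse_index :: "real mat \<Rightarrow> nat" where
  "morse_index B = (\<Sum>x | x < 0 \<and> eigenvalue B x. Polynomial.order x (char_poly B))"

definition J_mat :: "nat \<Rightarrow> real mat" where
  "J_mat n = four_block_mat (0\<^sub>m n n) (- (1\<^sub>m n)) (1\<^sub>m n) (0\<^sub>m n n)"

definition diagonalizable_mat :: "'a :: semiring_1 mat \<Rightarrow> bool" where
  "diagonalizable_mat A \<longleftrightarrow> (\<exists>D. diagonal_mat D \<and> similar_mat A D)"

definition spectrally_stable :: "real mat \<Rightarrow> bool" where
  "spectrally_stable A \<longleftrightarrow> (\<forall>z. eigenvalue (map_mat complex_of_real A) z \<longrightarrow> Re z = 0)"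

definition linearly_stable :: "real mat \<Rightarrow> bool" where
  "linearly_stable A \<longleftrightarrow>
     spectrally_stable A \<and> diagonalizable_mat (map_mat complex_of_real A)"

definition linearly_unstable :: "real mat \<Rightarrow> bool" where
  "linearly_unstable A \<longleftrightarrow> \<not> linearly_stable A"

end

theory Submission
  imports Defs
begin

text \<open>
  Choose an invertible \<open>P\<close> with \<open>P B P\<^sup>T = diag(B\<^sub>1, 0)\<close>, where \<open>B\<^sub>1\<close> is invertible and
  the zero block has size \<open>k = dim ker B\<close>. For every matrix \<open>N\<close> with lower right \<open>k \<times> k\<close> block
  \<open>N\<^sub>2\<^sub>2\<close>, the polynomial \<open>det(diag(B\<^sub>1, 0) + x N)\<close> is \<open>x\<^sup>k q(x)\<close> with
  \<open>q(0) = det B\<^sub>1 det N\<^sub>2\<^sub>2\<close>. The choices \<open>N = P J P\<^sup>T\<close> and \<open>N = P P\<^sup>T\<close> give, up to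
  positive factors and the sign of \<open>x\<close>, the characteristic polynomials of \<open>J B\<close> and of \<open>B\<close>.

  Suppose \<open>J B\<close> is linearly stable. In the first case \<open>N\<^sub>2\<^sub>2\<close> is skew-symmetric, and
  semisimplicity of the eigenvalue 0 makes it invertible; hence \<open>k\<close> is even and
  \<open>det N\<^sub>2\<^sub>2 > 0\<close>. As \<open>q\<close> has no positive root and a positive leading coefficient,
  \<open>q(0) \<ge> 0\<close>, so \<open>det B\<^sub>1 > 0\<close>. In the second case \<open>N\<^sub>2\<^sub>2\<close> is positive definite, so
  the characteristic polynomial of \<open>B\<close> is \<open>x\<^sup>k R(x)\<close> with \<open>R(0) > 0\<close> and \<open>R\<close> monic of
  even degree; such an \<open>R\<close> has an even number of negative roots.
\<close>

lemma poly_nonneg_at_0_if_no_pos_root: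
  fixes p :: "real poly"
  assumes "lead_coeff p > 0" and "\<And>x. x > 0 \<Longrightarrow> poly p x \<noteq> 0"
  shows "poly p 0 \<ge> 0"
proof (rule ccontr)
  assume "\<not> poly p 0 \<ge> 0"
  then have neg: "poly p 0 < 0" by simp
  obtain n where n: "\<And>x. x \<ge> n \<Longrightarrow> poly p x \<ge> lead_coeff p"
    using poly_pinfty_gt_lc[OF assms(1)] by blast
  then have "poly p (max n 1) > 0"
    using assms(1) by (meson less_le_trans max.cobounded1)
  then show False
    using poly_IVT_pos[OF _ neg, of "max n 1"] assms(2) by fastforce
qed

lemma sign_poly_0_and_negative_roots:
  fixes p :: "real poly"
  assumes "poly p 0 \<noteq> 0"
  shows "sgn (poly p 0) =
    (-1) ^ (degree p + size (filter_mset (\<lambda>x. x < 0) (proots p))) * sgn (lead_coeff p)"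
  using assms
proof (induction "degree p" arbitrary: p rule: less_induct)
  case less
  then have p0: "p \<noteq> 0" by auto
  show ?case
  proof (cases "\<exists>a<0. poly p a = 0")
    case True
    then obtain a where a: "a < 0" "poly p a = 0" by blast
    then obtain q where q: "p = [:-a, 1:] * q" by (metis dvdE poly_eq_0_iff_dvd)
    then have q0: "q \<noteq> 0" and qn: "poly q 0 \<noteq> 0" using p0 less.prems by auto
    have deg: "degree p = Suc (degree q)" using q q0 by (simp add: degree_mult_eq del: mult_pCons_left)
    have pr: "proots p = {#a#} + proots q" unfolding q using q0
      by (subst proots_mult) (auto simp del: mult_pCons_left)
    have lc: "lead_coeff p = lead_coeff q" unfolding q lead_coeff_mult by simp
    have "poly p 0 = -a * poly q 0" unfolding q by simp
    then have "sgn (poly p 0) = sgn (poly q 0)" using a by (simp add: sgn_mult)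
    then show ?thesis using less.hyps[of q] qn deg pr a lc by simp
  next
    case False
    then have e: "filter_mset (\<lambda>x. x < 0) (proots p) = {#}"
      using p0 by (auto intro!: multiset_eqI simp: count_eq_zero_iff)
    txt \<open>The sign \<open>c\<close> makes the leading coefficient of the reflected polynomial positive.\<close>
    define c where "c = (-1) ^ degree p * sgn (lead_coeff p)"
    define q where "q = Polynomial.smult c (pcompose p [:0, -1:])"
    have c: "c \<noteq> 0" using p0 by (simp add: c_def sgn_zero_iff)
    have pq: "poly q x = c * poly p (- x)" for x by (simp add: q_def poly_pcompose)
    have "lead_coeff q = c * (lead_coeff p * (-1) ^ degree p)"
      unfolding q_def by (subst lead_coeff_smult, subst lead_coeff_comp) auto
    also have "\<dots> = \<bar>lead_coeff p\<bar>"
      by (simp add: c_def abs_sgn algebra_simps flip: power_mult_distrib)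
    finally have "lead_coeff q > 0" using p0 by simp
    then have "poly q 0 \<ge> 0"
      by (rule poly_nonneg_at_0_if_no_pos_root) (use False c in \<open>auto simp: pq\<close>)
    then have "c * poly p 0 > 0" using less.prems c by (simp add: pq less_le)
    moreover have "\<bar>c\<bar> = 1" using p0 by (simp add: c_def abs_mult power_abs abs_sgn_eq)
    then have "c = 1 \<or> c = -1" by linarith
    ultimately have "sgn (poly p 0) = c" by auto
    then show ?thesis by (simp add: e c_def)
  qed
qed

lemma mult_mat_zero_vec:
  "A \<in> carrier_mat nr nc \<Longrightarrow> A *\<^sub>v 0\<^sub>v nc = (0\<^sub>v nr :: 'a :: semiring_0 vec)"
  by (intro eq_vecI) auto

lemma scalar_prod_self_pos:
  fixes v :: "real vec"
  assumes "v \<in> carrier_vec n" "v \<noteq> 0\<^sub>v n"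
  shows "v \<bullet> v > 0"
proof -
  obtain i where i: "i < n" "v $ i \<noteq> 0" using assms by (metis carrier_vecD eq_vecI index_zero_vec)
  have "0 < v $ i * v $ i" using i by (metis not_real_square_gt_zero)
  also have "\<dots> \<le> v \<bullet> v" unfolding scalar_prod_def
    by (rule member_le_sum) (use i assms in auto)
  finally show ?thesis .
qed

lemma poly_char_poly:
  fixes M :: "'a :: field mat"
  assumes "M \<in> carrier_mat n n"
  shows "poly (char_poly M) x = det (- M + x \<cdot>\<^sub>m 1\<^sub>m n)"
proof -
  have "- char_matrix M x = - M + x \<cdot>\<^sub>m 1\<^sub>m n"
    unfolding char_matrix_def using assms by (intro eq_matI) auto
  then show ?thesis using char_poly_matrix[of M n x] assms by simp
qed

lemma det_nonneg_if_quadratic_form_nonneg: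
  fixes M :: "real mat"
  assumes M: "M \<in> carrier_mat n n"
    and pos: "\<And>v. v \<in> carrier_vec n \<Longrightarrow> v \<bullet> (M *\<^sub>v v) \<ge> 0"
  shows "det M \<ge> 0"
proof -
  have "poly (char_poly (- M)) 0 \<ge> 0"
  proof (rule poly_nonneg_at_0_if_no_pos_root)
    show "lead_coeff (char_poly (- M)) > 0"
      using degree_monic_char_poly[of "- M" n] M by simp
    fix x :: real assume x: "x > 0"
    show "poly (char_poly (- M)) x \<noteq> 0"
    proof
      assume "poly (char_poly (- M)) x = 0"
      then have "eigenvalue (- M) x" using eigenvalue_root_char_poly[of "- M" n x] M by simp
      then obtain v where v: "v \<in> carrier_vec n" "v \<noteq> 0\<^sub>v n" and e: "- M *\<^sub>v v = x \<cdot>\<^sub>v v"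
        using M unfolding eigenvalue_def eigenvector_def by auto
      have "- (v \<bullet> (M *\<^sub>v v)) = v \<bullet> (- M *\<^sub>v v)" using M v by simp
      also have "\<dots> = x * (v \<bullet> v)" using e v by simp
      also have "\<dots> > 0" using x scalar_prod_self_pos[OF v] by simp
      finally show False using pos[OF v(1)] by simp
    qed
  qed
  moreover have "- (- M) + 0 \<cdot>\<^sub>m 1\<^sub>m n = M" using M by (intro eq_matI) auto
  ultimately show ?thesis using poly_char_poly[of "- M" n 0] M by simp
qed

lemma det_pos_if_quadratic_form_pos:
  fixes M :: "real mat"
  assumes M: "M \<in> carrier_mat n n"
    and pos: "\<And>v. v \<in> carrier_vec n \<Longrightarrow> v \<noteq> 0\<^sub>v n \<Longrightarrow> v \<bullet> (M *\<^sub>v v) > 0"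
  shows "det M > 0"
proof -
  have "det M \<noteq> 0" using det_0_iff_vec_prod_zero_field[OF M] pos by fastforce
  moreover have "det M \<ge> 0"
  proof (rule det_nonneg_if_quadratic_form_nonneg[OF M])
    fix v :: "real vec" assume v: "v \<in> carrier_vec n"
    show "v \<bullet> (M *\<^sub>v v) \<ge> 0"
      using pos[OF v] M by (cases "v = 0\<^sub>v n") (auto intro: less_imp_le)
  qed
  ultimately show ?thesis by simp
qed

lemma skew_quadratic_form_zero:
  fixes S :: "real mat"
  assumes S: "S \<in> carrier_mat n n" and skew: "transpose_mat S = - S"
    and v: "v \<in> carrier_vec n"
  shows "v \<bullet> (S *\<^sub>v v) = 0"
proof -
  have "v \<bullet> (S *\<^sub>v v) = (transpose_mat S *\<^sub>v v) \<bullet> v"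
    using transpose_vec_mult_scalar[OF S v v] by simp
  also have "\<dots> = - ((S *\<^sub>v v) \<bullet> v)" unfolding skew using S v by simp
  also have "(S *\<^sub>v v) \<bullet> v = v \<bullet> (S *\<^sub>v v)" using S v by (intro comm_scalar_prod) auto
  finally show ?thesis by simp
qed

definition lower_block :: "nat \<Rightarrow> nat \<Rightarrow> 'a mat \<Rightarrow> 'a mat" where
  "lower_block r k N = mat k k (\<lambda>(i, j). N $$ (i + r, j + r))"

lemma lower_block_carrier [simp]: "lower_block r k N \<in> carrier_mat k k"
  by (simp add: lower_block_def)

lemma four_block_lower_block:
  assumes "N \<in> carrier_mat (r + k) (r + k)"
  obtains N11 N12 N21 where
    "N11 \<in> carrier_mat r r" "N12 \<in> carrier_mat r k" "N21 \<in> carrier_mat k r"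
    "N = four_block_mat N11 N12 N21 (lower_block r k N)"
proof
  show "N = four_block_mat (mat r r (\<lambda>ij. N $$ ij)) (mat r k (\<lambda>(i, j). N $$ (i, j + r)))
    (mat k r (\<lambda>(i, j). N $$ (i + r, j))) (lower_block r k N)"
    using assms by (intro eq_matI) (auto simp: lower_block_def)
qed auto

lemma mult_vec_append_lower_block:
  fixes N :: "'a :: comm_ring_1 mat"
  assumes N: "N \<in> carrier_mat (r + k) (r + k)" and v: "v \<in> carrier_vec k"
  obtains u where "u \<in> carrier_vec r" "N *\<^sub>v (0\<^sub>v r @\<^sub>v v) = u @\<^sub>v (lower_block r k N *\<^sub>v v)"
proof -
  from four_block_lower_block[OF N] obtain N11 N12 N21 where
    b: "N11 \<in> carrier_mat r r" "N12 \<in> carrier_mat r k" "N21 \<in> carrier_mat k r"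
    and e: "N = four_block_mat N11 N12 N21 (lower_block r k N)" by blast
  have "N *\<^sub>v (0\<^sub>v r @\<^sub>v v) = (N12 *\<^sub>v v) @\<^sub>v (lower_block r k N *\<^sub>v v)"
    by (subst e, subst four_block_mat_mult_vec[OF b lower_block_carrier _ v])
      (use b v b(1,3)[THEN mult_mat_zero_vec] mult_mat_vec_carrier[OF lower_block_carrier v, of r N] in auto)
  then show thesis using b v by (intro that) auto
qed

lemma lower_block_quadratic_form:
  fixes N :: "'a :: comm_ring_1 mat"
  assumes N: "N \<in> carrier_mat (r + k) (r + k)" and v: "v \<in> carrier_vec k"
  shows "v \<bullet> (lower_block r k N *\<^sub>v v) = (0\<^sub>v r @\<^sub>v v) \<bullet> (N *\<^sub>v (0\<^sub>v r @\<^sub>v v))"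
proof -
  from mult_vec_append_lower_block[OF N v] obtain u where
    u: "u \<in> carrier_vec r" "N *\<^sub>v (0\<^sub>v r @\<^sub>v v) = u @\<^sub>v (lower_block r k N *\<^sub>v v)" by blast
  show ?thesis unfolding u(2)
    by (subst scalar_prod_append[where ?n1.0 = r and ?n2.0 = k])
      (use u v in \<open>auto intro: mult_mat_vec_carrier[OF lower_block_carrier]\<close>)
qed

lemma det_block_pencil:
  fixes N :: "'a :: field mat"
  assumes N: "N \<in> carrier_mat (r + k) (r + k)" and B: "B \<in> carrier_mat r r"
  obtains q where
    "\<And>x. det (four_block_mat B (0\<^sub>m r k) (0\<^sub>m k r) (0\<^sub>m k k) + x \<cdot>\<^sub>m N) = x ^ k * poly q x"
    "poly q 0 = det B * det (lower_block r k N)"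
proof -
  from four_block_lower_block[OF N] obtain N11 N12 N21 where
    b: "N11 \<in> carrier_mat r r" "N12 \<in> carrier_mat r k" "N21 \<in> carrier_mat k r"
    and e: "N = four_block_mat N11 N12 N21 (lower_block r k N)" by blast
  define N22 where "N22 = lower_block r k N"
  have b4: "N22 \<in> carrier_mat k k" by (simp add: N22_def)
  note e = e[folded N22_def]
  define q where "q = det (four_block_mat
    (map_mat (\<lambda>a. [:a:]) B + map_mat (\<lambda>a. [:0, a:]) N11) (map_mat (\<lambda>a. [:0, a:]) N12)
    (map_mat (\<lambda>a. [:a:]) N21) (map_mat (\<lambda>a. [:a:]) N22))"
  have q: "poly q x = det (four_block_mat (B + x \<cdot>\<^sub>m N11) (x \<cdot>\<^sub>m N12) N21 N22)" for x
    unfolding q_def by (rule poly_det_cong[of _ "r + k"]) (use b b4 B in auto)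
  show thesis
  proof
    fix x :: 'a
    let ?E = "four_block_mat (1\<^sub>m r) (0\<^sub>m r k) (0\<^sub>m k r) (x \<cdot>\<^sub>m 1\<^sub>m k)"
    have "four_block_mat B (0\<^sub>m r k) (0\<^sub>m k r) (0\<^sub>m k k) + x \<cdot>\<^sub>m N =
      four_block_mat (B + x \<cdot>\<^sub>m N11) (x \<cdot>\<^sub>m N12) (x \<cdot>\<^sub>m N21) (x \<cdot>\<^sub>m N22)"
      by (subst e) (use B b b4 in \<open>intro eq_matI, auto\<close>)
    also have "\<dots> = ?E * four_block_mat (B + x \<cdot>\<^sub>m N11) (x \<cdot>\<^sub>m N12) N21 N22"
      by (subst mult_four_block_mat[of _ r r _ k _ k _ _ r _ k])
        (use B b b4 in \<open>auto simp: mult_smult_assoc_mat[of _ k k]\<close>)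
    finally have m: "four_block_mat B (0\<^sub>m r k) (0\<^sub>m k r) (0\<^sub>m k k) + x \<cdot>\<^sub>m N =
      ?E * four_block_mat (B + x \<cdot>\<^sub>m N11) (x \<cdot>\<^sub>m N12) N21 N22" .
    have "det ?E = x ^ k"
      by (subst det_four_block_mat_upper_right_zero[of _ r _ k]) auto
    then show "det (four_block_mat B (0\<^sub>m r k) (0\<^sub>m k r) (0\<^sub>m k k) + x \<cdot>\<^sub>m N) = x ^ k * poly q x"
      unfolding m q by (subst det_mult[of _ "r + k"]) (use B b b4 in auto)
  next
    have "B + 0 \<cdot>\<^sub>m N11 = B" "0 \<cdot>\<^sub>m N12 = 0\<^sub>m r k" using B b by (auto intro!: eq_matI)
    then show "poly q 0 = det B * det (lower_block r k N)"
      unfolding q N22_def[symmetric]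
      using det_four_block_mat_upper_right_zero[OF B _ b(3) b4] by simp
  qed
qed

lemma diagonal_mat_mult_vec:
  fixes D :: "'a :: comm_ring_1 mat"
  assumes D: "D \<in> carrier_mat n n" "diagonal_mat D" and u: "u \<in> carrier_vec n" and i: "i < n"
  shows "(D *\<^sub>v u) $ i = D $$ (i, i) * u $ i"
proof -
  have "(D *\<^sub>v u) $ i = (\<Sum>j = 0..<n. D $$ (i, j) * u $ j)"
    using D u i by (simp add: scalar_prod_def)
  also have "\<dots> = (\<Sum>j = 0..<n. if j = i then D $$ (i, i) * u $ i else 0)"
    by (rule sum.cong) (use D i in \<open>auto simp: diagonal_mat_def\<close>)
  finally show ?thesis using i by simp
qed

lemma diagonalizable_kernel_square:
  fixes A :: "'a :: field mat"
  assumes A: "A \<in> carrier_mat n n" and "diagonalizable_mat A"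
    and z: "z \<in> carrier_vec n" and AAz: "A *\<^sub>v (A *\<^sub>v z) = 0\<^sub>v n"
  shows "A *\<^sub>v z = 0\<^sub>v n"
proof -
  from assms obtain D X Y where D: "diagonal_mat D" and w: "similar_mat_wit A D X Y"
    by (auto simp: diagonalizable_mat_def similar_mat_def)
  note w = similar_mat_witD2[OF A w]
  define u where "u = Y *\<^sub>v z"
  have u: "u \<in> carrier_vec n" using w z by (auto simp: u_def)
  have YX: "Y *\<^sub>v (X *\<^sub>v a) = a" if "a \<in> carrier_vec n" for a
    using assoc_mult_mat_vec[OF w(7,6) that] w(2) that by simp
  have XDY: "A *\<^sub>v a = X *\<^sub>v (D *\<^sub>v (Y *\<^sub>v a))" if "a \<in> carrier_vec n" for a
    unfolding w(3) using w that
    by (simp add: assoc_mult_mat_vec[of _ n n _ n] del: assoc_mult_mat)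
  have Az: "A *\<^sub>v z = X *\<^sub>v (D *\<^sub>v u)" using XDY[OF z] by (simp add: u_def)
  have "D *\<^sub>v (D *\<^sub>v u) = Y *\<^sub>v (A *\<^sub>v (A *\<^sub>v z))"
    unfolding XDY[OF mult_mat_vec_carrier[OF A z]] unfolding Az using w(5-7) u by (simp add: YX)
  also have "\<dots> = 0\<^sub>v n" unfolding AAz using w(7) by (rule mult_mat_zero_vec)
  finally have DD: "D *\<^sub>v (D *\<^sub>v u) = 0\<^sub>v n" .
  have "D *\<^sub>v u = 0\<^sub>v n"
  proof (rule eq_vecI)
    fix i assume "i < dim_vec (0\<^sub>v n :: 'a vec)"
    then have i: "i < n" by simp
    have "D $$ (i, i) * (D $$ (i, i) * u $ i) = (D *\<^sub>v (D *\<^sub>v u)) $ i"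
      using diagonal_mat_mult_vec[OF w(5) D _ i] w u by simp
    also have "\<dots> = 0" using DD i by simp
    finally show "(D *\<^sub>v u) $ i = 0\<^sub>v n $ i"
      using diagonal_mat_mult_vec[OF w(5) D u i] i by auto
  qed (use w in auto)
  then show ?thesis using Az mult_mat_zero_vec[OF w(6)] by simp
qed

lemma diagonalizable_complex_kernel_square:
  fixes A :: "real mat"
  assumes A: "A \<in> carrier_mat n n" and d: "diagonalizable_mat (map_mat complex_of_real A)"
    and z: "z \<in> carrier_vec n" and AAz: "A *\<^sub>v (A *\<^sub>v z) = 0\<^sub>v n"
  shows "A *\<^sub>v z = 0\<^sub>v n"
proof -
  let ?h = "map_vec complex_of_real"
  have h: "?h (A *\<^sub>v v) = map_mat complex_of_real A *\<^sub>v ?h v" if "v \<in> carrier_vec n" for v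
    using of_real_hom.mult_mat_vec_hom[OF A that] .
  have zero: "?h (0\<^sub>v n) = 0\<^sub>v n" by (intro eq_vecI) auto
  have "map_mat complex_of_real A *\<^sub>v (map_mat complex_of_real A *\<^sub>v ?h z) =
      ?h (A *\<^sub>v (A *\<^sub>v z))"
    unfolding h[OF mult_mat_vec_carrier[OF A z]] h[OF z] ..
  also have "\<dots> = 0\<^sub>v n" unfolding AAz by (rule zero)
  finally have "map_mat complex_of_real A *\<^sub>v ?h z = 0\<^sub>v n"
    by (rule diagonalizable_kernel_square[OF _ d, rotated 2]) (use A z in auto)
  then have "?h (A *\<^sub>v z) = ?h (0\<^sub>v n)" unfolding h[OF z] zero .
  then show ?thesis by (rule of_real_hom.vec_hom_inj)
qed

lemma transpose_congruence:
  fixes M :: "'a :: comm_ring_1 mat"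
  assumes "P \<in> carrier_mat n n" "M \<in> carrier_mat n n"
  shows "transpose_mat (P * M * transpose_mat P) = P * transpose_mat M * transpose_mat P"
proof -
  have "transpose_mat (P * M * transpose_mat P) = P * transpose_mat (P * M)"
    using assms by (subst transpose_mult[of _ n n _ n]) auto
  also have "transpose_mat (P * M) = transpose_mat M * transpose_mat P"
    using assms by (intro transpose_mult) auto
  finally show ?thesis using assms by (subst assoc_mult_mat[of _ n n _ n _ n]) auto
qed

lemma symmetric_congruence_normal_form:
  fixes B :: "'a :: field mat"
  assumes B: "B \<in> carrier_mat N N" and sym: "transpose_mat B = B"
  obtains P B1 r where "P \<in> carrier_mat N N" "det P \<noteq> 0" "N = r + kernel_dim B"
    "B1 \<in> carrier_mat r r" "det B1 \<noteq> 0"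
    "P * B * transpose_mat P =
      four_block_mat B1 (0\<^sub>m r (kernel_dim B)) (0\<^sub>m (kernel_dim B) r) (0\<^sub>m (kernel_dim B) (kernel_dim B))"
proof -
  define C where "C = gauss_jordan_single B"
  note gj = gauss_jordan_single[OF B C_def[symmetric]]
  from gj(4) obtain P Q where C: "C = P * B" and P: "P \<in> carrier_mat N N"
    and Q: "Q \<in> carrier_mat N N" and QP: "Q * P = 1\<^sub>m N" by blast
  note Cc = gj(2)
  from gj(3) Cc obtain f where f: "pivot_fun C f N" by (auto simp: row_echelon_form_def)
  have dimC: "dim_row C = N" using Cc by simp
  note piv = pivot_funD[OF dimC f]
  define r where "r = (LEAST i. i \<ge> N \<or> f i = N)"
  have r_prop: "r \<ge> N \<or> f r = N" unfolding r_def by (rule LeastI[of _ N]) simp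
  have rN: "r \<le> N" unfolding r_def by (rule Least_le) simp
  have below: "f i < N" if "i < r" for i
    using not_less_Least[OF that[unfolded r_def]] piv(1)[of i] by simp
  have above: "r \<le> i \<Longrightarrow> i < N \<Longrightarrow> f i = N" for i
  proof (induction i rule: dec_induct)
    case base then show ?case using r_prop by simp
  next
    case (step i)
    then show ?case using piv(1)[of "Suc i"] piv(3)[of i] by simp
  qed
  have "i < N \<and> row C i \<noteq> 0\<^sub>v N \<longleftrightarrow> i < r" for i
    using pivot_fun_zero_row_iff[OF f Cc, of i] below[of i] above[of i] rN by linarith
  then have "{i. i < N \<and> row C i \<noteq> 0\<^sub>v N} = {..<r}" by auto
  then have k: "kernel_dim B = N - r"
    using find_base_vectors(5)[OF gj(3) Cc] B unfolding kernel_dim_code C_def[symmetric] by simp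
  then have N: "N = r + kernel_dim B" using rN by simp
  define M where "M = P * B * transpose_mat P"
  have M: "M \<in> carrier_mat N N" using P B by (simp add: M_def)
  have M_C: "M = C * transpose_mat P" by (simp add: M_def C)
  have symM: "transpose_mat M = M"
    unfolding M_def transpose_congruence[OF P B] sym ..
  have M_sym: "M $$ (i, j) = M $$ (j, i)" if "i < N" "j < N" for i j
    using symM that M by (metis carrier_matD index_transpose_mat(1))
  have M_rows: "M $$ (i, j) = 0" if "r \<le> i" "i < N" "j < N" for i j
  proof -
    have "row C i = 0\<^sub>v N" using pivot_fun_zero_row_iff[OF f Cc] above that by simp
    then show ?thesis unfolding M_C using Cc P that by simp
  qed
  have M_cols: "M $$ (i, j) = 0" if "r \<le> j" "j < N" "i < N" for i j
    using M_sym[of i j] M_rows[of j i] that by simp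
  define B1 where "B1 = mat r r (\<lambda>ij. M $$ ij)"
  have B1: "B1 \<in> carrier_mat r r" by (simp add: B1_def)
  let ?k = "kernel_dim B"
  have M4: "M = four_block_mat B1 (0\<^sub>m r ?k) (0\<^sub>m ?k r) (0\<^sub>m ?k ?k)"
    using M N M_rows M_cols by (intro eq_matI) (auto simp: B1_def)
  have "det B1 \<noteq> 0"
  proof
    assume "det B1 = 0"
    then obtain v where v: "v \<in> carrier_vec r" "v \<noteq> 0\<^sub>v r" "B1 *\<^sub>v v = 0\<^sub>v r"
      using det_0_iff_vec_prod_zero_field[OF B1] by blast
    define w where "w = v @\<^sub>v 0\<^sub>v ?k"
    have w: "w \<in> carrier_vec N" unfolding w_def by (subst N) (use v in auto)
    have "M *\<^sub>v w = 0\<^sub>v r @\<^sub>v 0\<^sub>v ?k"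
      unfolding M4 w_def by (subst four_block_mat_mult_vec[of _ r r _ ?k _ ?k]) (use B1 v in auto)
    also have "\<dots> = 0\<^sub>v N" using N by (intro eq_vecI) auto
    finally have "M *\<^sub>v w = 0\<^sub>v N" .
    moreover have "M = P * transpose_mat C"
      using arg_cong[OF M_C, of transpose_mat] P Cc
      by (simp add: symM transpose_mult[of _ N N _ N])
    ultimately have "P *\<^sub>v (transpose_mat C *\<^sub>v w) = 0\<^sub>v N"
      using P Cc w by (metis assoc_mult_mat_vec transpose_carrier_mat)
    then have "Q *\<^sub>v (P *\<^sub>v (transpose_mat C *\<^sub>v w)) = 0\<^sub>v N"
      using mult_mat_zero_vec[OF Q] by simp
    then have Cw: "transpose_mat C *\<^sub>v w = 0\<^sub>v N"
      using assoc_mult_mat_vec[OF Q P, of "transpose_mat C *\<^sub>v w"] QP Cc w by simp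
    have "v = 0\<^sub>v r"
    proof (rule eq_vecI)
      fix i assume "i < dim_vec (0\<^sub>v r :: 'a vec)"
      then have i: "i < r" by simp
      then have iN: "i < N" using rN by simp
      have "col C (f i) = unit_vec N i"
        using piv(4,5)[OF iN below[OF i]] Cc below[OF i] by (intro eq_vecI) (auto simp: unit_vec_def)
      then have "w $ i = (transpose_mat C *\<^sub>v w) $ f i"
        using Cc below[OF i] w iN by simp
      then show "v $ i = 0\<^sub>v r $ i" using Cw below[OF i] i v by (simp add: w_def)
    qed (use v in simp)
    with v show False by simp
  qed
  moreover have "det P \<noteq> 0"
    using det_mult[OF Q P] QP by auto
  ultimately show thesis using that[OF P _ N B1] M4 by (simp add: M_def)
qed

lemma J_mat_carrier: "J_mat n \<in> carrier_mat (2 * n) (2 * n)"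
  unfolding J_mat_def mult_2 by (intro four_block_carrier_mat) auto

lemma transpose_J_mat: "transpose_mat (J_mat n) = - J_mat n"
  unfolding J_mat_def by (intro eq_matI) auto

lemma J_mat_square: "J_mat n * J_mat n = - 1\<^sub>m (2 * n)"
proof -
  have "J_mat n * J_mat n =
    four_block_mat (- (1\<^sub>m n)) (0\<^sub>m n n) (0\<^sub>m n n) (- (1\<^sub>m n))"
    unfolding J_mat_def by (subst mult_four_block_mat[of _ n n _ n _ n _ _ n _ n]) auto
  also have "\<dots> = - 1\<^sub>m (2 * n)" by (intro eq_matI) auto
  finally show ?thesis .
qed

lemma det_uminus:
  fixes M :: "'a :: comm_ring_1 mat"
  assumes "M \<in> carrier_mat n n"
  shows "det (- M) = (- 1) ^ n * det M"
proof -
  have "- M = (- 1) \<cdot>\<^sub>m M" by (intro eq_matI) auto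
  then show ?thesis using assms by simp
qed

lemma det_J_mat_pos: "det (J_mat n) > 0"
proof -
  have "det (- 1\<^sub>m (2 * n) :: real mat) = 1"
    using det_uminus[of "1\<^sub>m (2 * n) :: real mat" "2 * n"] by simp
  then have "det (J_mat n) * det (J_mat n) = 1"
    using det_mult[OF J_mat_carrier J_mat_carrier, of n] unfolding J_mat_square by metis
  moreover have "det (J_mat n) \<ge> 0"
    by (rule det_nonneg_if_quadratic_form_nonneg[OF J_mat_carrier])
      (simp add: skew_quadratic_form_zero[OF J_mat_carrier transpose_J_mat])
  ultimately show ?thesis by (metis less_eq_real_def mult_zero_left zero_neq_one)
qed

lemma morse_index_proots:
  assumes B: "B \<in> carrier_mat n n"
  shows "morse_index B = size (filter_mset (\<lambda>x. x < 0) (proots (char_poly B)))"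
proof -
  let ?F = "filter_mset (\<lambda>x. x < 0) (proots (char_poly B))"
  have nz: "char_poly B \<noteq> 0" using degree_monic_char_poly[OF B] by auto
  have "set_mset ?F = {x. x < 0 \<and> eigenvalue B x}"
    using nz by (auto simp: eigenvalue_root_char_poly[OF B])
  then show ?thesis
    unfolding morse_index_def size_multiset_overloaded_eq by (auto intro!: sum.cong simp: nz)
qed

lemma det_congruence:
  fixes M :: "'a :: comm_ring_1 mat"
  assumes "P \<in> carrier_mat n n" "M \<in> carrier_mat n n"
  shows "det (P * M * transpose_mat P) = (det P)\<^sup>2 * det M"
  using assms by (simp add: det_mult[of _ n] det_transpose power2_eq_square)

lemma congruence_pencil:
  fixes M :: "'a :: comm_ring_1 mat"
  assumes "P \<in> carrier_mat n n" "M \<in> carrier_mat n n" "K \<in> carrier_mat n n"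
  shows "P * (M + x \<cdot>\<^sub>m K) * transpose_mat P =
    P * M * transpose_mat P + x \<cdot>\<^sub>m (P * K * transpose_mat P)"
proof -
  have "P * (M + x \<cdot>\<^sub>m K) = P * M + x \<cdot>\<^sub>m (P * K)"
    using assms by (simp add: mult_add_distrib_mat[of _ n n _ n] mult_smult_distrib[of _ n n _ n])
  moreover have "\<dots> * transpose_mat P = P * M * transpose_mat P + x \<cdot>\<^sub>m (P * K * transpose_mat P)"
    using assms by (simp add: add_mult_distrib_mat[of _ n n _ _ n] mult_smult_assoc_mat[of _ n n _ n])
  ultimately show ?thesis by simp
qed

theorem theorem1:
  fixes n :: nat and B :: "real mat"
  assumes "n \<ge> 1"
    and "B \<in> carrier_mat (2 * n) (2 * n)"
    and "transpose_mat B = B"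
    and "odd (kernel_dim B) \<or> odd (morse_index B)"
  shows "linearly_unstable (J_mat n * B)"
proof (rule ccontr)
  assume "\<not> linearly_unstable (J_mat n * B)"
  then have spec: "spectrally_stable (J_mat n * B)"
    and diag: "diagonalizable_mat (map_mat complex_of_real (J_mat n * B))"
    by (auto simp: linearly_unstable_def linearly_stable_def)
  define N where "N = 2 * n"
  define J where "J = J_mat n"
  define k where "k = kernel_dim B"
  have B: "B \<in> carrier_mat N N" and J: "J \<in> carrier_mat N N"
    using assms(2) J_mat_carrier by (auto simp: N_def J_def)
  have JB: "J * B \<in> carrier_mat N N" using J B by simp
  have JT: "transpose_mat J = - J" by (simp add: J_def transpose_J_mat)
  have JJ: "J * J = - 1\<^sub>m N" by (simp add: J_def N_def J_mat_square)
  obtain P B1 r where P: "P \<in> carrier_mat N N" and detP: "det P \<noteq> 0" and Nrk: "N = r + k"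
    and B1: "B1 \<in> carrier_mat r r" and detB1: "det B1 \<noteq> 0"
    and PBP: "P * B * transpose_mat P = four_block_mat B1 (0\<^sub>m r k) (0\<^sub>m k r) (0\<^sub>m k k)"
    using symmetric_congruence_normal_form[OF B assms(3)] unfolding k_def by metis
  have PT: "transpose_mat P \<in> carrier_mat N N" using P by simp
  define S where "S = P * J * transpose_mat P"
  define S22 where "S22 = lower_block r k S"
  have S: "S \<in> carrier_mat N N" using P J by (simp add: S_def)
  note S' = S[unfolded Nrk]
  have S22: "S22 \<in> carrier_mat k k" by (simp add: S22_def)
  have ST: "transpose_mat S = - S"
    unfolding S_def transpose_congruence[OF P J] JT using P J by simp
  have S22_nonneg: "det S22 \<ge> 0"
  proof (rule det_nonneg_if_quadratic_form_nonneg[OF S22])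
    fix v :: "real vec" assume v: "v \<in> carrier_vec k"
    show "v \<bullet> (S22 *\<^sub>v v) \<ge> 0"
      unfolding S22_def lower_block_quadratic_form[OF S' v]
      using skew_quadratic_form_zero[OF S' ST[unfolded Nrk], of "0\<^sub>v r @\<^sub>v v"] v by simp
  qed

  txt \<open>
    A kernel vector of \<open>S22\<close> yields \<open>y \<noteq> 0\<close> and \<open>z\<close> with \<open>B y = 0\<close> and
    \<open>B z = J y\<close>, so that \<open>J B z = - y\<close>: a Jordan chain for the eigenvalue 0.
  \<close>
  have "det S22 \<noteq> 0"
  proof
    assume "det S22 = 0"
    then obtain v where v: "v \<in> carrier_vec k" "v \<noteq> 0\<^sub>v k" "S22 *\<^sub>v v = 0\<^sub>v k"
      using det_0_iff_vec_prod_zero_field[OF S22] by blast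
    define e where "e = 0\<^sub>v r @\<^sub>v v"
    have e: "e \<in> carrier_vec N" unfolding e_def Nrk using v by simp
    from mult_vec_append_lower_block[OF S' v(1)] obtain u where u: "u \<in> carrier_vec r"
      and Se: "S *\<^sub>v e = u @\<^sub>v 0\<^sub>v k"
      unfolding e_def[symmetric] S22_def[symmetric] v(3) by blast
    obtain w1 where w1: "w1 \<in> carrier_vec r" "B1 *\<^sub>v w1 = u"
    proof -
      obtain Q where Q: "Q \<in> carrier_mat r r" "B1 * Q = 1\<^sub>m r"
        using det_non_zero_imp_unit[OF B1 detB1, of "()"] unfolding Units_def ring_mat_def by auto
      have "B1 *\<^sub>v (Q *\<^sub>v u) = u"
        using assoc_mult_mat_vec[OF B1 Q(1) u] Q(2) u by simp
      then show thesis using Q u by (intro that[of "Q *\<^sub>v u"]) auto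
    qed
    define w where "w = w1 @\<^sub>v 0\<^sub>v k"
    have w: "w \<in> carrier_vec N" unfolding w_def Nrk using w1 by simp
    have Bw: "P * B * transpose_mat P *\<^sub>v w = S *\<^sub>v e"
      unfolding PBP w_def Se
      by (subst four_block_mat_mult_vec[of _ r r _ k _ k]) (use B1 w1 u in auto)
    have Be: "P * B * transpose_mat P *\<^sub>v e = 0\<^sub>v N"
    proof -
      have "P * B * transpose_mat P *\<^sub>v e = 0\<^sub>v r @\<^sub>v 0\<^sub>v k"
        unfolding PBP e_def
        by (subst four_block_mat_mult_vec[of _ r r _ k _ k])
          (use B1 mult_mat_zero_vec[OF B1] v in auto)
      also have "\<dots> = 0\<^sub>v N" unfolding Nrk by (intro eq_vecI) auto
      finally show ?thesis .
    qed
    have P_cancel: "a = b" if "P *\<^sub>v a = P *\<^sub>v b" "a \<in> carrier_vec N" "b \<in> carrier_vec N" for a b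
    proof -
      have "P *\<^sub>v (a - b) = 0\<^sub>v N" using that P by (simp add: mult_minus_distrib_mat_vec)
      moreover have "a - b \<in> carrier_vec N" using that by simp
      ultimately have ab: "a - b = 0\<^sub>v N"
        using det_0_iff_vec_prod_zero_field[OF P] detP by blast
      show ?thesis
      proof (rule eq_vecI)
        fix i assume "i < dim_vec b"
        then show "a $ i = b $ i" using arg_cong[OF ab, of "\<lambda>v. v $ i"] that by simp
      qed (use that in simp)
    qed
    define y where "y = transpose_mat P *\<^sub>v e"
    define z where "z = transpose_mat P *\<^sub>v w"
    have y: "y \<in> carrier_vec N" and z: "z \<in> carrier_vec N" using PT e w by (auto simp: y_def z_def)
    have conj: "P * M * transpose_mat P *\<^sub>v a = P *\<^sub>v (M *\<^sub>v (transpose_mat P *\<^sub>v a))"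
      if "M \<in> carrier_mat N N" "a \<in> carrier_vec N" for M a
      using P PT that by (simp add: assoc_mult_mat_vec[of _ N N _ N] del: assoc_mult_mat)
    have By: "B *\<^sub>v y = 0\<^sub>v N"
    proof (rule P_cancel)
      show "P *\<^sub>v (B *\<^sub>v y) = P *\<^sub>v 0\<^sub>v N"
        using Be conj[OF B e] mult_mat_zero_vec[OF P] by (simp add: y_def)
    qed (use B y in auto)
    have Bz: "B *\<^sub>v z = J *\<^sub>v y"
    proof (rule P_cancel)
      show "P *\<^sub>v (B *\<^sub>v z) = P *\<^sub>v (J *\<^sub>v y)"
        using Bw conj[OF B w] conj[OF J e] by (simp add: y_def z_def S_def)
    qed (use B J y z in auto)
    have JBz: "(J * B) *\<^sub>v z = - y"
    proof -
      have "(J * B) *\<^sub>v z = (J * J) *\<^sub>v y" using J B y z Bz by simp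
      then show ?thesis unfolding JJ using y by simp
    qed
    have "(J * B) *\<^sub>v ((J * B) *\<^sub>v z) = 0\<^sub>v N"
    proof -
      have "- y = (- 1) \<cdot>\<^sub>v y" by (intro eq_vecI) auto
      moreover have "(- 1) \<cdot>\<^sub>v 0\<^sub>v N = (0\<^sub>v N :: real vec)" by (intro eq_vecI) auto
      ultimately have "B *\<^sub>v (- y) = 0\<^sub>v N" by (simp add: mult_mat_vec[OF B y] By)
      then show ?thesis unfolding JBz using J B y mult_mat_zero_vec[OF J] by simp
    qed
    then have "- y = 0\<^sub>v N"
      using diagonalizable_complex_kernel_square[OF JB diag[folded J_def] z] JBz by simp
    then have "transpose_mat P *\<^sub>v e = 0\<^sub>v N" using y by (metis uminus_zero_vec uminus_uminus_vec y_def)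
    moreover have "det (transpose_mat P) \<noteq> 0" using detP det_transpose[OF P] by simp
    ultimately have "e = 0\<^sub>v N" using det_0_iff_vec_prod_zero_field[OF PT] e by blast
    have "v = 0\<^sub>v k"
    proof (rule eq_vecI)
      fix i assume "i < dim_vec (0\<^sub>v k :: real vec)"
      then have i: "i < k" by simp
      then have "e $ (i + r) = v $ i" using v by (simp add: e_def)
      then show "v $ i = 0\<^sub>v k $ i" using i \<open>e = 0\<^sub>v N\<close> Nrk by simp
    qed (use v in simp)
    with v show False by simp
  qed
  with S22_nonneg have S22_pos: "det S22 > 0" by simp

  have even_k: "even k"
  proof -
    have "transpose_mat S22 = - S22"
    proof (rule eq_matI)
      fix i j assume "i < dim_row (- S22)" "j < dim_col (- S22)"
      then have ij: "i < k" "j < k" using S22 by auto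
      have "S $$ (j + r, i + r) = transpose_mat S $$ (i + r, j + r)" using ij S' by simp
      also have "\<dots> = - S $$ (i + r, j + r)" unfolding ST using ij S' by simp
      finally show "transpose_mat S22 $$ (i, j) = (- S22) $$ (i, j)"
        using ij by (simp add: S22_def lower_block_def)
    qed (use S22 in auto)
    then have "det S22 = (- 1) ^ k * det S22"
      using det_transpose[OF S22] det_uminus[OF S22] by simp
    with S22_pos show ?thesis by (cases "even k") auto
  qed

  obtain q where q: "\<And>x. det (P * B * transpose_mat P + x \<cdot>\<^sub>m S) = x ^ k * poly q x"
    and q0: "poly q 0 = det B1 * det S22"
    using det_block_pencil[OF S' B1] unfolding PBP S22_def by metis
  define c where "c = det J / (det P)\<^sup>2"
  have c: "c > 0" using det_J_mat_pos detP by (simp add: c_def J_def)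
  have char_JB: "poly (char_poly (J * B)) x = x ^ k * (c * poly q x)" for x
  proof -
    have "- (J * B) + x \<cdot>\<^sub>m 1\<^sub>m N = - (J * B) + x \<cdot>\<^sub>m (- (J * J))" unfolding JJ by simp
    also have "\<dots> = - J * (B + x \<cdot>\<^sub>m J)"
      using J B by (simp add: mult_add_distrib_mat[of _ N N _ N] mult_smult_distrib[of _ N N _ N])
    finally have "poly (char_poly (J * B)) x = det (- J) * det (B + x \<cdot>\<^sub>m J)"
      using poly_char_poly[OF JB, of x] det_mult[of "- J" N "B + x \<cdot>\<^sub>m J"] J B by simp
    also have "det (- J) = det J" using JT det_transpose[OF J] by simp
    also have "(det P)\<^sup>2 * det (B + x \<cdot>\<^sub>m J) = x ^ k * poly q x"
      using det_congruence[OF P, of "B + x \<cdot>\<^sub>m J"] congruence_pencil[OF P B J, of x] q[of x] B J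
      by (simp add: S_def)
    then have "det (B + x \<cdot>\<^sub>m J) = x ^ k * poly q x / (det P)\<^sup>2"
      using detP by (simp add: field_simps)
    finally show ?thesis by (simp add: c_def)
  qed
  have "poly q 0 \<ge> 0"
  proof (rule poly_nonneg_at_0_if_no_pos_root)
    have "char_poly (J * B) = monom 1 k * Polynomial.smult c q"
      by (rule poly_ext) (simp add: char_JB poly_monom)
    then have "lead_coeff (char_poly (J * B)) = c * lead_coeff q"
      by (simp add: lead_coeff_mult degree_monom_eq)
    then have "c * lead_coeff q = 1" using degree_monic_char_poly[OF JB] by metis
    then have "0 < c * lead_coeff q" by simp
    then show "lead_coeff q > 0" using c by (rule zero_less_mult_pos)
    fix x :: real assume x: "x > 0"
    show "poly q x \<noteq> 0"
    proof
      assume "poly q x = 0"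
      then have "eigenvalue (J * B) x"
        using char_JB by (simp add: eigenvalue_root_char_poly[OF JB])
      then have "eigenvalue (map_mat complex_of_real (J * B)) (complex_of_real x)"
        by (rule of_real_hom.eigenvalue_hom[OF JB])
      then show False using spec x unfolding spectrally_stable_def J_def by fastforce
    qed
  qed
  then have B1_pos: "det B1 > 0" using q0 S22_pos detB1 by (simp add: zero_le_mult_iff)

  define G where "G = P * 1\<^sub>m N * transpose_mat P"
  have G: "G \<in> carrier_mat (r + k) (r + k)" using P by (simp add: G_def Nrk)
  have G22_pos: "det (lower_block r k G) > 0"
  proof (rule det_pos_if_quadratic_form_pos)
    fix v :: "real vec" assume v: "v \<in> carrier_vec k" "v \<noteq> 0\<^sub>v k"
    define e where "e = 0\<^sub>v r @\<^sub>v v"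
    have e: "e \<in> carrier_vec N" unfolding e_def Nrk using v by simp
    obtain i where "i < k" "v $ i \<noteq> 0" using v by (metis carrier_vecD eq_vecI index_zero_vec)
    then have "e $ (i + r) \<noteq> 0\<^sub>v N $ (i + r)" using v by (simp add: e_def Nrk)
    then have "e \<noteq> 0\<^sub>v N" by metis
    then have "transpose_mat P *\<^sub>v e \<noteq> 0\<^sub>v N"
      using det_0_iff_vec_prod_zero_field[OF PT] det_transpose[OF P] detP e by auto
    then have "0 < (transpose_mat P *\<^sub>v e) \<bullet> (transpose_mat P *\<^sub>v e)"
      by (intro scalar_prod_self_pos) (use PT e in auto)
    also have "\<dots> = e \<bullet> (P *\<^sub>v (transpose_mat P *\<^sub>v e))"
      using transpose_vec_mult_scalar[OF P _ e] PT e by simp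
    also have "\<dots> = e \<bullet> (G *\<^sub>v e)" using P PT e by (simp add: G_def)
    also have "\<dots> = v \<bullet> (lower_block r k G *\<^sub>v v)"
      unfolding e_def lower_block_quadratic_form[OF G v(1)] ..
    finally show "0 < v \<bullet> (lower_block r k G *\<^sub>v v)" .
  qed simp
  obtain q2 where q2: "\<And>x. det (P * B * transpose_mat P + x \<cdot>\<^sub>m G) = x ^ k * poly q2 x"
    and q20: "poly q2 0 = det B1 * det (lower_block r k G)"
    using det_block_pencil[OF G B1] unfolding PBP by metis
  define R where "R = Polynomial.smult (1 / (det P)\<^sup>2) (pcompose q2 [:0, -1:])"
  have R: "poly R x = poly q2 (- x) / (det P)\<^sup>2" for x by (simp add: R_def poly_pcompose)
  have char_B: "char_poly B = monom 1 k * R"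
  proof (rule poly_ext)
    fix x
    have "- B + x \<cdot>\<^sub>m 1\<^sub>m N = - (B + (- x) \<cdot>\<^sub>m 1\<^sub>m N)"
      using B by (intro eq_matI) auto
    then have "poly (char_poly B) x = det (B + (- x) \<cdot>\<^sub>m 1\<^sub>m N)"
      using poly_char_poly[OF B, of x] det_uminus[of "B + (- x) \<cdot>\<^sub>m 1\<^sub>m N" N] B
      by (simp add: N_def)
    moreover have "(det P)\<^sup>2 * det (B + (- x) \<cdot>\<^sub>m 1\<^sub>m N) = (- x) ^ k * poly q2 (- x)"
      using det_congruence[OF P, of "B + (- x) \<cdot>\<^sub>m 1\<^sub>m N"]
        congruence_pencil[OF P B one_carrier_mat, of "- x"] q2[of "- x"] B
      by (simp add: G_def)
    ultimately show "poly (char_poly B) x = poly (monom 1 k * R) x"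
      using detP even_k by (simp add: R poly_monom field_simps)
  qed
  have nz: "char_poly B \<noteq> 0" using degree_monic_char_poly[OF B] by auto
  then have R_nz: "R \<noteq> 0" by (auto simp: char_B)
  have degR: "degree R = r"
    using degree_monic_char_poly[OF B] R_nz
    by (simp add: char_B degree_mult_eq degree_monom_eq monom_eq_0_iff Nrk)
  have "lead_coeff (char_poly B) = lead_coeff R"
    by (simp add: char_B lead_coeff_mult degree_monom_eq)
  then have leadR: "lead_coeff R = 1" using degree_monic_char_poly[OF B] by metis
  have "poly R 0 > 0" using B1_pos G22_pos detP by (simp add: R q20)
  then have "(- 1 :: real) ^ (degree R + size (filter_mset (\<lambda>x. x < 0) (proots R))) = 1"
    using sign_poly_0_and_negative_roots[of R] leadR by simp
  moreover have "even (degree R)" using even_k Nrk degR by (metis N_def even_add even_mult_iff even_numeral)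
  ultimately have "even (size (filter_mset (\<lambda>x. x < 0) (proots R)))"
    by (metis even_add neg_one_odd_power one_neq_neg_one)
  moreover have "filter_mset (\<lambda>x. x < 0) (proots (monom 1 k * R)) =
      filter_mset (\<lambda>x. x < 0) (proots R)"
    by (rule multiset_eqI) (use R_nz in \<open>auto simp: proots_mult monom_eq_0_iff poly_monom order_0I\<close>)
  ultimately have "even (morse_index B)" by (simp add: morse_index_proots[OF B] char_B)
  with even_k assms(4) show False by (simp add: k_def)
qed

end
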